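(* Let $A$ be a ring. Then the mapping on ideals of $A$ given by $I \mapsto I^{\boxed{\#}}$ is a closure operation.
   Context: All rings are commutative with identity. For an ideal $I$ of a ring $A$, let $I^{\#}$ be the ideal of $A$ generated by $\{x \in A \mid x^n \in I^n \text{ for some } n \ge 1\}$; let $I^{\#_1} = I^{\#}$ and, for $\ell > 1$, $I^{\#_\ell} = \langle x \in A \mid x^n \in (I^{\#_{\ell-1}})^n \text{ for some } n \ge 1\rangle$; let $I^{\boxed{\#}} = \bigcup_{\ell \ge 1} I^{\#_\ell}$ (an increasing union of ideals). A closure operation $\square$ on the set of ideals of $A$ is a mapping $I \mapsto I^{\square}$ from ideals to ideals such that: (1) $I \subseteq I^{\square}$ for all ideals $I$ of $A$; (2) for all ideals $I, J$ of $A$ with $I \subseteq J$, $I^{\square} \subseteq J^{\square}$; (3) $I^{\square} = (I^{\square})^{\square}$ for all ideals $I$ of $A$. *)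

theory Defs
  imports "HOL-Algebra.Algebra"
begin

(* Powers I^n are taken in the monoid of ideals of R under the ideal product. *)
definition sharp :: "('a, 'b) ring_scheme \<Rightarrow> 'a set \<Rightarrow> 'a set"
  where "sharp R I =
    Idl\<^bsub>R\<^esub> {x \<in> carrier R. \<exists>n::nat. n \<ge> 1 \<and> x [^]\<^bsub>R\<^esub> n \<in> I [^]\<^bsub>ideals_set R\<^esub> n}"

(* With sharp_iter R 0 I = I, the index 1 gives sharp R I and the index l > 1
   gives sharp R (sharp_iter R (l - 1) I). *)
definition sharp_iter :: "('a, 'b) ring_scheme \<Rightarrow> nat \<Rightarrow> 'a set \<Rightarrow> 'a set"
  where "sharp_iter R l I = (sharp R ^^ l) I"

definition box_sharp :: "('a, 'b) ring_scheme \<Rightarrow> 'a set \<Rightarrow> 'a set"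
  where "box_sharp R I = (\<Union>l\<in>{1..}. sharp_iter R l I)"

(* An operation on ideals is a total function on sets; only its values on
   ideals matter, and these are required to be ideals again. *)
definition closure_operation :: "('a, 'b) ring_scheme \<Rightarrow> ('a set \<Rightarrow> 'a set) \<Rightarrow> bool"
  where "closure_operation R c \<longleftrightarrow>
    (\<forall>I. ideal I R \<longrightarrow> ideal (c I) R) \<and>
    (\<forall>I. ideal I R \<longrightarrow> I \<subseteq> c I) \<and>
    (\<forall>I J. ideal I R \<longrightarrow> ideal J R \<longrightarrow> I \<subseteq> J \<longrightarrow> c I \<subseteq> c J) \<and>
    (\<forall>I. ideal I R \<longrightarrow> c I = c (c I))"

end

theory Submission
  imports Defs
begin

text \<open>
  Everything except idempotence is formal: \<open>I \<subseteq> I\<^sup>#\<close> because the exponent 1 is allowed in the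
  definition, and \<open>\<^sup>#\<close> is monotone because ideal powers are. So the iterates of an ideal form an
  increasing chain of ideals, whose union is again an ideal.

  Idempotence rests on a finiteness argument (\<open>ideal_pow_UN_subset\<close>): an element of \<open>(\<Union>l. J l)\<^sup>n\<close>
  is a finite sum of \<open>n\<close>-fold products, so only finitely many elements of the union occur in it, and
  for an increasing chain they all lie in one member \<open>J l\<close>; the element is therefore in \<open>(J l)\<^sup>n\<close>.
  Let \<open>K\<close> be the union of the iterates of \<open>I\<close>. If \<open>x\<^sup>n \<in> K\<^sup>n\<close>, then \<open>x\<^sup>n\<close> lies in the \<open>n\<close>-th power
  of a single iterate, hence \<open>x\<close> lies in the next iterate and so in \<open>K\<close>. This gives \<open>K\<^sup># \<subseteq> K\<close>, and
  all further iterates of \<open>K\<close> remain inside \<open>K\<close>.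
\<close>

section \<open>Products and powers of ideals\<close>

lemma ideals_set_one: "\<one>\<^bsub>ideals_set R\<^esub> = carrier R"
  by (simp add: ideals_set_def)

lemma ideals_set_mult: "I \<otimes>\<^bsub>ideals_set R\<^esub> J = ideal_prod R I J"
  by (simp add: ideals_set_def)

lemma ideal_prod_mono:
  assumes "I \<subseteq> I'" "J \<subseteq> J'"
  shows "ideal_prod R I J \<subseteq> ideal_prod R I' J'"
proof
  fix s assume "s \<in> ideal_prod R I J"
  thus "s \<in> ideal_prod R I' J'"
    by (induct rule: ideal_prod.induct) (use assms in \<open>auto intro: ideal_prod.intros\<close>)
qed

lemma ideal_pow_mono:
  fixes n :: nat
  assumes "I \<subseteq> J"
  shows "I [^]\<^bsub>ideals_set R\<^esub> n \<subseteq> J [^]\<^bsub>ideals_set R\<^esub> n"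
  by (induct n) (simp_all add: ideals_set_mult ideal_prod_mono assms)

lemma incseq_UN_memD2:
  fixes P Q :: "nat \<Rightarrow> 'a set"
  assumes "incseq P" "incseq Q" "x \<in> (\<Union>l. P l)" "y \<in> (\<Union>l. Q l)"
  obtains l where "x \<in> P l" "y \<in> Q l"
proof -
  from assms(3,4) obtain i j where "x \<in> P i" "y \<in> Q j" by blast
  hence "x \<in> P (max i j)" "y \<in> Q (max i j)"
    using monoD[OF assms(1), of i "max i j"] monoD[OF assms(2), of j "max i j"] by auto
  thus thesis by (rule that)
qed

lemma ideal_prod_UN_subset:
  fixes P Q :: "nat \<Rightarrow> 'a set"
  assumes "incseq P" "incseq Q"
  shows "ideal_prod R (\<Union>l. P l) (\<Union>l. Q l) \<subseteq> (\<Union>l. ideal_prod R (P l) (Q l))"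
proof
  have inc: "incseq (\<lambda>l. ideal_prod R (P l) (Q l))"
    using assms by (simp add: incseq_def ideal_prod_mono)
  fix s assume "s \<in> ideal_prod R (\<Union>l. P l) (\<Union>l. Q l)"
  thus "s \<in> (\<Union>l. ideal_prod R (P l) (Q l))"
  proof (induct rule: ideal_prod.induct)
    case (prod i j)
    with assms obtain l where "i \<in> P l" "j \<in> Q l" by (rule incseq_UN_memD2)
    thus ?case by (blast intro: ideal_prod.prod)
  next
    case (sum s1 s2)
    obtain l where "s1 \<in> ideal_prod R (P l) (Q l)" "s2 \<in> ideal_prod R (P l) (Q l)"
      using inc inc sum(2,4) by (rule incseq_UN_memD2)
    thus ?case by (blast intro: ideal_prod.sum)
  qed
qed

text \<open>
  By induction on \<open>n\<close>: the powers \<open>(J l)\<^sup>n\<close> again increase with \<open>l\<close>, so the two factors of each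
  product in \<open>(\<Union>l. J l)\<^sup>n \<cdot> (\<Union>l. J l)\<close> can be moved to a common index.
\<close>
lemma ideal_pow_UN_subset:
  fixes J :: "nat \<Rightarrow> 'a set" and n :: nat
  assumes "incseq J"
  shows "(\<Union>l. J l) [^]\<^bsub>ideals_set R\<^esub> n \<subseteq> (\<Union>l. J l [^]\<^bsub>ideals_set R\<^esub> n)"
proof (induct n)
  case 0
  show ?case by simp
next
  case (Suc n)
  have "incseq (\<lambda>l. J l [^]\<^bsub>ideals_set R\<^esub> n)"
    using assms by (simp add: incseq_def ideal_pow_mono)
  from ideal_prod_UN_subset[OF this assms, of R] show ?case
    using ideal_prod_mono[OF Suc order_refl, of R "\<Union>l. J l"]
    by (simp add: ideals_set_mult)
qed

section \<open>The sharp operation and its iterates\<close>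

lemma (in ring) sharp_ideal: "ideal (sharp R I) R"
  unfolding sharp_def by (rule genideal_ideal) blast

lemma (in ring) sharp_memI:
  fixes n :: nat
  assumes "x \<in> carrier R" "n \<ge> 1" "x [^] n \<in> I [^]\<^bsub>ideals_set R\<^esub> n"
  shows "x \<in> sharp R I"
  unfolding sharp_def using assms by (intro subsetD[OF genideal_self]) auto

lemma (in ring) sharp_leastI:
  assumes "ideal J R"
    and "\<And>x n::nat. \<lbrakk>x \<in> carrier R; n \<ge> 1; x [^] n \<in> I [^]\<^bsub>ideals_set R\<^esub> n\<rbrakk> \<Longrightarrow> x \<in> J"
  shows "sharp R I \<subseteq> J"
  unfolding sharp_def using assms by (intro genideal_minimal) auto

lemma (in ring) sharp_extensive:
  assumes "ideal I R"
  shows "I \<subseteq> sharp R I"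
proof
  fix x assume x: "x \<in> I"
  hence xc: "x \<in> carrier R" using assms by (rule ideal.Icarr[rotated])
  have "\<one> \<otimes> x \<in> carrier R \<cdot> I" using x by (intro ideal_prod.prod) auto
  hence "x [^] Suc 0 \<in> I [^]\<^bsub>ideals_set R\<^esub> Suc 0"
    using xc by (simp add: ideals_set_mult ideals_set_one)
  with xc show "x \<in> sharp R I" by (intro sharp_memI[of x "Suc 0"]) auto
qed

lemma (in ring) sharp_mono:
  assumes "I \<subseteq> J"
  shows "sharp R I \<subseteq> sharp R J"
  using ideal_pow_mono[OF assms] by (intro sharp_leastI sharp_ideal) (blast intro: sharp_memI)

lemma sharp_iter_0: "sharp_iter R 0 I = I"
  by (simp add: sharp_iter_def)

lemma sharp_iter_Suc: "sharp_iter R (Suc l) I = sharp R (sharp_iter R l I)"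
  by (simp add: sharp_iter_def)

lemma (in ring) sharp_iter_ideal: "ideal I R \<Longrightarrow> ideal (sharp_iter R l I) R"
  by (cases l) (simp_all add: sharp_iter_0 sharp_iter_Suc sharp_ideal)

lemma (in ring) sharp_iter_mono: "I \<subseteq> J \<Longrightarrow> sharp_iter R l I \<subseteq> sharp_iter R l J"
  by (induct l) (simp_all add: sharp_iter_0 sharp_iter_Suc sharp_mono)

lemma (in ring) incseq_sharp_iter:
  assumes "ideal I R"
  shows "incseq (\<lambda>l. sharp_iter R l I)"
  by (rule incseq_SucI) (simp add: sharp_iter_Suc sharp_extensive sharp_iter_ideal assms)

lemma (in ring) sharp_iter_subset_fixed:
  assumes "sharp R K \<subseteq> K"
  shows "sharp_iter R l K \<subseteq> K"
proof (induct l)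
  case (Suc l)
  from sharp_mono[OF Suc] assms show ?case by (simp add: sharp_iter_Suc)
qed (simp add: sharp_iter_0)

section \<open>The union of the iterates\<close>

text \<open>
  Since \<open>I \<subseteq> I\<^sup>#\<close>, the union may start at \<open>I\<close> itself, which makes it a union over all
  natural numbers.
\<close>
lemma (in ring) box_sharp_eq_UN:
  assumes "ideal I R"
  shows "box_sharp R I = (\<Union>l. sharp_iter R l I)"
proof
  show "box_sharp R I \<subseteq> (\<Union>l. sharp_iter R l I)" by (auto simp: box_sharp_def)
  show "(\<Union>l. sharp_iter R l I) \<subseteq> box_sharp R I"
    using incseq_SucD[OF incseq_sharp_iter[OF assms]] by (fastforce simp: box_sharp_def)
qed

lemma (in ring) box_sharp_ideal:
  assumes "ideal I R"
  shows "ideal (box_sharp R I) R"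
proof -
  let ?C = "range (\<lambda>l. sharp_iter R l I)"
  have "sharp_iter R i I \<subseteq> sharp_iter R j I \<or> sharp_iter R j I \<subseteq> sharp_iter R i I" for i j
    using incseq_sharp_iter[OF assms] nat_le_linear[of i j] by (auto simp: incseq_def)
  hence "subset.chain {I. ideal I R} ?C"
    using sharp_iter_ideal[OF assms] by (auto simp: subset.chain_def subset_iff_psubset_eq)
  from chain_Union_is_ideal[OF this] show ?thesis
    by (simp add: box_sharp_eq_UN assms)
qed

lemma (in ring) box_sharp_extensive: "ideal I R \<Longrightarrow> I \<subseteq> box_sharp R I"
  using sharp_iter_0[of R I] by (auto simp: box_sharp_eq_UN)

lemma (in ring) box_sharp_mono: "I \<subseteq> J \<Longrightarrow> box_sharp R I \<subseteq> box_sharp R J"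
  using sharp_iter_mono unfolding box_sharp_def by blast

text \<open>
  The finiteness argument places \<open>x\<^sup>n\<close> in the \<open>n\<close>-th power of one iterate, and the next iterate
  then contains \<open>x\<close>.
\<close>
lemma (in ring) sharp_box_sharp_subset:
  assumes "ideal I R"
  shows "sharp R (box_sharp R I) \<subseteq> box_sharp R I"
proof (rule sharp_leastI[OF box_sharp_ideal[OF assms]])
  fix x and n :: nat
  assume x: "x \<in> carrier R" "n \<ge> 1" "x [^] n \<in> box_sharp R I [^]\<^bsub>ideals_set R\<^esub> n"
  then obtain l where "x [^] n \<in> sharp_iter R l I [^]\<^bsub>ideals_set R\<^esub> n"
    using ideal_pow_UN_subset[OF incseq_sharp_iter[OF assms], of R n]
    by (auto simp: box_sharp_eq_UN assms)
  with x have "x \<in> sharp_iter R (Suc l) I"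
    by (simp add: sharp_iter_Suc sharp_memI)
  thus "x \<in> box_sharp R I" by (auto simp: box_sharp_def)
qed

lemma (in ring) box_sharp_idem:
  assumes "ideal I R"
  shows "box_sharp R (box_sharp R I) = box_sharp R I"
proof
  show "box_sharp R (box_sharp R I) \<subseteq> box_sharp R I"
    using sharp_iter_subset_fixed[OF sharp_box_sharp_subset[OF assms]]
    by (auto simp: box_sharp_def[of R "box_sharp R I"])
  show "box_sharp R I \<subseteq> box_sharp R (box_sharp R I)"
    by (rule box_sharp_extensive[OF box_sharp_ideal[OF assms]])
qed

theorem proposition2p6:
  fixes A :: "('a, 'b) ring_scheme"
  assumes "cring A"
  shows "closure_operation A (box_sharp A)"
proof -
  interpret cring A by fact
  show ?thesis
    unfolding closure_operation_def
    by (simp add: box_sharp_ideal box_sharp_extensive box_sharp_mono box_sharp_idem)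
qed

end
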